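(* Let $\mathbb F$ be a field, $d\ge1$ an integer, $A=A(d,\mathbb F)$. Let $n,m\ge1$ and let $(r_1,\ldots,r_n)$ and $(r'_1,\ldots,r'_m)$ be NR words in $A$ that end with a nonstarred element. Then the product $$P=(r_1,r_2,\ldots,r_n)\cdot(r'_1,r'_2,\ldots,r'_m)$$ is the following linear combination of NR words in $A$ that end with a nonstarred element. (i) If $m$ is odd and $r_n\ne r'_1$, then $P=0$. (ii) If $m$ is odd and $r_n=r'_1$, then $P=(r_1,r_2,\ldots,r_n,r'_2,\ldots,r'_m)$. (iii) If $m$ is even and $r_n\neq r'_1$, then $P=(r_1,r_2,\ldots,r_n,r'_1,r'_2,\ldots,r'_m)$. (iv) If $m$ is even and $r_n=r'_1$, then $$P=(-1)^{n+1}(r_1,\ldots,r_n,r'_2,\ldots,r'_m)+(-1)^n\sum_{\substack{0\le j\le d\\ j\ne r_1}}(j,r_1,\ldots,r_n,r'_2,\ldots,r'_m)+\sum_{\ell=1}^{n-1}(-1)^{n-\ell}\sum_{\substack{0\le j\le d\\ j\ne r_\ell,\ j\ne r_{\ell+1}}}(r_1,\ldots,r_\ell,j,r_{\ell+1},\ldots,r_n,r'_2,\ldots,r'_m).$$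
   Context: Algebras are associative and have a $1$. For a field $\mathbb F$ and an integer $d\ge 1$, $A=A(d,\mathbb F)$ is the $\mathbb F$-algebra defined by generators $\{e_i\}_{i=0}^d$, $\{e^*_i\}_{i=0}^d$ and relations $e_ie_j=\delta_{i,j}e_i$, $e^*_ie^*_j=\delta_{i,j}e^*_i$ $(0\le i,j\le d)$, $1=\sum_{i=0}^d e_i$, $1=\sum_{i=0}^d e^*_i$. The $e_i,e_i^*$ are the idempotent generators; the $e^*_i$ are called starred and the $e_i$ nonstarred; $i$ is the index of $e_i$ and of $e^*_i$. For $n\ge1$, a word of length $n$ in $A$ is a product $g_1g_2\cdots g_n$ of idempotent generators such that for $2\le j\le n$ exactly one of $g_{j-1},g_j$ is starred. It begins with $g_1$ and ends with $g_n$. The word is nonrepeating (NR) if $g_{j-1},g_j$ have different indices for $2\le j\le n$. Notation: for $r_1,\dots,r_n\in\{0,\dots,d\}$, $(r_1,\ldots,r_n)$ denotes the word $g_1\cdots g_n$ of length $n$ such that $g_n$ is nonstarred and $g_j$ has index $r_j$ for $1\le j\le n$ (so $g_n=e_{r_n}$, $g_{n-1}=e^*_{r_{n-1}}$, $g_{n-2}=e_{r_{n-2}}$, and so on, alternating). The NR words ending with a nonstarred element form a basis of the $\mathbb F$-vector space $A$. *)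

theory Defs
  imports "HOL-Algebra.QuotRing" "HOL-Algebra.Module"
begin

section \<open>Free algebras\<close>

text \<open>
  The free associative unital \<open>F\<close>-algebra on the generating set \<open>X\<close>: finitely supported functions
  from the words over \<open>X\<close> to \<open>F\<close>. The coefficient of a word \<open>w\<close> in a product is the sum over all
  ways of splitting \<open>w\<close> into a prefix and a suffix.
\<close>

definition free_algebra :: "('f, 'm) ring_scheme \<Rightarrow> 'g set \<Rightarrow> ('f, 'g list \<Rightarrow> 'f) module" where
  "free_algebra F X =
    \<lparr>carrier = {p. range p \<subseteq> carrier F \<and> finite {w. p w \<noteq> \<zero>\<^bsub>F\<^esub>} \<and> {w. p w \<noteq> \<zero>\<^bsub>F\<^esub>} \<subseteq> lists X},
     mult = (\<lambda>p q w. \<Oplus>\<^bsub>F\<^esub>k\<in>{..length w}. p (take k w) \<otimes>\<^bsub>F\<^esub> q (drop k w)),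
     one = (\<lambda>w. if w = [] then \<one>\<^bsub>F\<^esub> else \<zero>\<^bsub>F\<^esub>),
     zero = (\<lambda>w. \<zero>\<^bsub>F\<^esub>),
     add = (\<lambda>p q w. p w \<oplus>\<^bsub>F\<^esub> q w),
     smult = (\<lambda>c p w. c \<otimes>\<^bsub>F\<^esub> p w)\<rparr>"

definition free_gen :: "('f, 'm) ring_scheme \<Rightarrow> 'g \<Rightarrow> 'g list \<Rightarrow> 'f" where
  "free_gen F g = (\<lambda>w. if w = [g] then \<one>\<^bsub>F\<^esub> else \<zero>\<^bsub>F\<^esub>)"

text \<open>
  The library quotient \<open>R Quot I\<close> is only a ring; the scalar multiplication is carried over from \<open>R\<close>
  in the same way as the library carries over the product (see \<open>rcoset_mult\<close>).
\<close>

definition quot_algebra :: "('f, 'a, 'm) module_scheme \<Rightarrow> 'a set \<Rightarrow> ('f, 'a set) module" where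
  "quot_algebra R I =
    ring.extend (R Quot I) (module.fields (\<lambda>c X. \<Union>x\<in>X. I +>\<^bsub>R\<^esub> (c \<odot>\<^bsub>R\<^esub> x)))"

section \<open>The algebra \<open>A(d, F)\<close>\<close>

datatype idem = Nonstar (index: nat) | Star (index: nat)

primrec starred :: "idem \<Rightarrow> bool" where
  "starred (Nonstar i) = False"
| "starred (Star i) = True"

definition idems :: "nat \<Rightarrow> idem set" where
  "idems d = {g. index g \<le> d}"

text \<open>Each relation \<open>x = y\<close> is encoded as the element \<open>x - y\<close> of the free algebra.\<close>

definition A_relators :: "('f, 'm) ring_scheme \<Rightarrow> nat \<Rightarrow> (idem list \<Rightarrow> 'f) set" where
  "A_relators F d =
    (let R = free_algebra F (idems d);
         e = (\<lambda>i. free_gen F (Nonstar i));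
         es = (\<lambda>i. free_gen F (Star i))
     in {(e i \<otimes>\<^bsub>R\<^esub> e j) \<ominus>\<^bsub>R\<^esub> (if i = j then e i else \<zero>\<^bsub>R\<^esub>) | i j. i \<le> d \<and> j \<le> d}
        \<union> {(es i \<otimes>\<^bsub>R\<^esub> es j) \<ominus>\<^bsub>R\<^esub> (if i = j then es i else \<zero>\<^bsub>R\<^esub>) | i j. i \<le> d \<and> j \<le> d}
        \<union> {\<one>\<^bsub>R\<^esub> \<ominus>\<^bsub>R\<^esub> (\<Oplus>\<^bsub>R\<^esub>i\<in>{..d}. e i), \<one>\<^bsub>R\<^esub> \<ominus>\<^bsub>R\<^esub> (\<Oplus>\<^bsub>R\<^esub>i\<in>{..d}. es i)})"

definition A_ideal :: "('f, 'm) ring_scheme \<Rightarrow> nat \<Rightarrow> (idem list \<Rightarrow> 'f) set" where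
  "A_ideal F d = Idl\<^bsub>free_algebra F (idems d)\<^esub> (A_relators F d)"

definition A_algebra :: "('f, 'm) ring_scheme \<Rightarrow> nat \<Rightarrow> ('f, (idem list \<Rightarrow> 'f) set) module" where
  "A_algebra F d = quot_algebra (free_algebra F (idems d)) (A_ideal F d)"

definition A_gen :: "('f, 'm) ring_scheme \<Rightarrow> nat \<Rightarrow> idem \<Rightarrow> (idem list \<Rightarrow> 'f) set" where
  "A_gen F d g = A_ideal F d +>\<^bsub>free_algebra F (idems d)\<^esub> free_gen F g"

section \<open>Words\<close>

text \<open>
  Words are handled as sequences \<open>g\<^sub>1, \<dots>, g\<^sub>n\<close> of generators; \<open>A_prod\<close> gives the element
  \<open>g\<^sub>1 \<cdots> g\<^sub>n\<close> of the algebra.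
\<close>

definition is_word :: "nat \<Rightarrow> idem list \<Rightarrow> bool" where
  "is_word d gs \<longleftrightarrow>
    gs \<noteq> [] \<and> set gs \<subseteq> idems d \<and> successively (\<lambda>g h. starred g \<noteq> starred h) gs"

definition nonrepeating :: "idem list \<Rightarrow> bool" where
  "nonrepeating gs \<longleftrightarrow> successively (\<lambda>g h. index g \<noteq> index h) gs"

definition NR_nonstar :: "nat \<Rightarrow> idem list \<Rightarrow> bool" where
  "NR_nonstar d gs \<longleftrightarrow> is_word d gs \<and> nonrepeating gs \<and> \<not> starred (last gs)"

definition A_prod :: "('f, 'm) ring_scheme \<Rightarrow> nat \<Rightarrow> idem list \<Rightarrow> (idem list \<Rightarrow> 'f) set" where
  "A_prod F d gs = foldr (\<otimes>\<^bsub>A_algebra F d\<^esub>) (map (A_gen F d) gs) \<one>\<^bsub>A_algebra F d\<^esub>"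

text \<open>
  The sequence of generators of the word \<open>(r\<^sub>1, \<dots>, r\<^sub>n)\<close>: the last generator is nonstarred, so a
  generator is nonstarred iff the number of generators to its right is even.
\<close>

primrec bracket :: "nat list \<Rightarrow> idem list" where
  "bracket [] = []"
| "bracket (r # rs) = (if even (length rs) then Nonstar r else Star r) # bracket rs"

end

theory Submission
  imports Defs "HOL-Algebra.UnivPoly"
begin

text \<open>
  Only the case \<open>m\<close> even, \<open>r\<^sub>n = r'\<^sub>1\<close> is more than concatenation or a single relation. Write \<open>t\<close> for
  \<open>r'\<^sub>2, \<dots>, r'\<^sub>m\<close> and let \<open>U\<^sub>l\<close> be the word \<open>(r\<^sub>1, \<dots>, r\<^sub>l, r\<^sub>l, \<dots>, r\<^sub>n, t)\<close>, so that the product is \<open>U\<^sub>n\<close>.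
  Inserting all indices \<open>j\<close> between \<open>r\<^sub>l\<close> and \<open>r\<^sub>l\<^sub>+\<^sub>1\<close> amounts to inserting \<open>1\<close>, which leaves two adjacent
  generators of the same kind with different indices, hence \<open>0\<close>. Splitting off \<open>j = r\<^sub>l\<close> and
  \<open>j = r\<^sub>l\<^sub>+\<^sub>1\<close> gives \<open>T\<^sub>l + U\<^sub>l + U\<^sub>l\<^sub>+\<^sub>1 = 0\<close>, where \<open>T\<^sub>l\<close> is the sum over the remaining \<open>j\<close>. In front of
  \<open>r\<^sub>1\<close> the same insertion gives \<open>(r\<^sub>1, \<dots>, r\<^sub>n, t) = T\<^sub>0 + U\<^sub>1\<close>, and the recurrence unrolls to the
  alternating sum.
\<close>

section \<open>Free algebras and their quotients\<close>

lemma (in abelian_monoid) finsum_triangle: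
  assumes "\<And>i j. f i j \<in> carrier G"
  shows "(\<Oplus>k\<in>{..n::nat}. \<Oplus>j\<in>{..k}. f j (k - j)) = (\<Oplus>j\<in>{..n}. \<Oplus>i\<in>{..n - j}. f j i)"
proof (induction n)
  case 0
  then show ?case using assms by simp
next
  case (Suc n)
  \<comment> \<open>The sums run over the pairs with \<open>j + i \<le> n\<close>, on the left
    diagonal by diagonal, on the right row by row. Raising \<open>n\<close> by one extends each old
    row by one entry and adds the one-entry row \<open>j = Suc n\<close>; together these entries
    form the new diagonal.\<close>
  have "(\<Oplus>j\<in>{..n}. \<Oplus>i\<in>{..Suc n - j}. f j i)
      = (\<Oplus>j\<in>{..n}. (\<Oplus>i\<in>{..n - j}. f j i) \<oplus> f j (Suc n - j))"
    by (rule finsum_cong')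
      (auto simp: assms Suc_diff_le finsum_closed a_comm Pi_def)
  also have "\<dots> = (\<Oplus>j\<in>{..n}. \<Oplus>i\<in>{..n - j}. f j i) \<oplus> (\<Oplus>j\<in>{..n}. f j (Suc n - j))"
    by (rule finsum_addf) (auto simp: assms)
  finally show ?case
    using Suc by (simp add: assms a_ac)
qed

lemma (in abelian_monoid) finsum_nonzero_ex:
  assumes "finsum G f A \<noteq> \<zero>"
  obtains x where "x \<in> A" "f x \<noteq> \<zero>"
  using assms add.finprod_one_eqI[of A f] by auto

lemma (in abelian_group) finsum_minus:
  assumes "f \<in> A \<rightarrow> carrier G"
  shows "(\<Oplus>x\<in>A. \<ominus> f x) = \<ominus> finsum G f A"
proof -
  have neg: "(\<lambda>x. \<ominus> f x) \<in> A \<rightarrow> carrier G"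
    using assms by auto
  have "(\<Oplus>x\<in>A. \<ominus> f x) \<oplus> finsum G f A = (\<Oplus>x\<in>A. \<ominus> f x \<oplus> f x)"
    using finsum_addf[OF neg assms] by simp
  also have "\<dots> = \<zero>"
    using assms by (intro add.finprod_one_eqI) (simp add: l_neg Pi_iff)
  finally show ?thesis
    using assms neg by (intro minus_equality[symmetric]) auto
qed

lemma (in abelian_monoid) finsum_remove2:
  assumes "finite S" "f \<in> S \<rightarrow> carrier G" "a \<in> S" "b \<in> S" "a \<noteq> b"
  shows "finsum G f S = finsum G f (S - {a, b}) \<oplus> (f a \<oplus> f b)"
proof -
  have "S = insert a (insert b (S - {a, b}))"
    using assms by auto
  then have "finsum G f S = finsum G f (insert a (insert b (S - {a, b})))"
    by simp
  also have "\<dots> = f a \<oplus> (f b \<oplus> finsum G f (S - {a, b}))"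
    using assms by (subst finsum_insert; auto)+
  finally show ?thesis
    using assms by (simp add: a_ac Pi_def)
qed

text \<open>This solves the recurrence \<open>U (Suc l) = - U l - T l\<close> with initial value
  \<open>U 1 = x - y\<close>. The sign \<open>sg\<close> is a case distinction because an abelian
  group has no scalars; it is matched with powers of -1 in the ground ring later.\<close>

lemma (in abelian_group) alternating_recurrence:
  fixes U T :: "nat \<Rightarrow> 'a"
  defines "sg \<equiv> \<lambda>(k::nat) x. if even k then x else \<ominus> x"
  assumes U: "\<And>k. U k \<in> carrier G" and T: "\<And>k. T k \<in> carrier G"
    and x: "x \<in> carrier G" and y: "y \<in> carrier G"
    and base: "x = y \<oplus> U 1"
    and step: "\<And>l. 1 \<le> l \<Longrightarrow> l < n \<Longrightarrow> T l \<oplus> (U l \<oplus> U (Suc l)) = \<zero>"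
    and k: "1 \<le> k" "k \<le> n"
  shows "U k = sg (k + 1) x \<oplus> sg k y \<oplus> (\<Oplus>l\<in>{1..k - 1}. sg (k - l) (T l))"
  using k
proof (induction k rule: dec_induct)
  case base
  show ?case
    using U x y assms(6) by (simp add: sg_def a_ac r_neg2)
next
  case (step k)
  have sg: "sg i z \<in> carrier G" "sg (Suc i) z = \<ominus> sg i z" if "z \<in> carrier G" for i z
    using that by (auto simp: sg_def)
  let ?S = "\<Oplus>l\<in>{1..k - 1}. sg (k - l) (T l)"
  have S: "?S \<in> carrier G"
    using T by (intro finsum_closed) (auto simp: sg)
  have "(\<Oplus>l\<in>{1..Suc k - 1}. sg (Suc k - l) (T l))
      = (\<Oplus>l\<in>insert k {1..k - 1}. sg (Suc k - l) (T l))"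
    using step by (intro finsum_cong') (auto simp: sg T)
  \<comment> \<open>The new term \<open>l = k\<close> carries the sign \<open>sg 1\<close>; in all
    other terms the exponent grows by one, which negates the old sum.\<close>
  also have "\<dots> = \<ominus> T k \<oplus> (\<Oplus>l\<in>{1..k - 1}. sg (Suc k - l) (T l))"
    using step by (subst finsum_insert) (auto simp: sg T, simp add: sg_def)
  also have "(\<Oplus>l\<in>{1..k - 1}. sg (Suc k - l) (T l)) = (\<Oplus>l\<in>{1..k - 1}. \<ominus> sg (k - l) (T l))"
    using step by (intro finsum_cong') (auto simp: sg T Suc_diff_le)
  also have "\<dots> = \<ominus> ?S"
    by (rule finsum_minus) (auto simp: sg T)
  finally have sum: "(\<Oplus>l\<in>{1..Suc k - 1}. sg (Suc k - l) (T l)) = \<ominus> T k \<oplus> \<ominus> ?S" .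
  have "T k \<oplus> (U k \<oplus> U (Suc k)) = \<zero>"
    using step.hyps step.prems by (intro assms(7)) auto
  then have "U (Suc k) \<oplus> (T k \<oplus> U k) = \<zero>"
    using U T by (simp add: a_ac)
  then have "U (Suc k) = \<ominus> (T k \<oplus> U k)"
    using U T by (intro minus_equality[symmetric]) auto
  also have "\<dots> = \<ominus> T k \<oplus> \<ominus> U k"
    using U T by (simp add: minus_add)
  also have "U k = sg (k + 1) x \<oplus> sg k y \<oplus> ?S"
    using step by simp
  also have "\<ominus> T k \<oplus> \<ominus> (sg (k + 1) x \<oplus> sg k y \<oplus> ?S)
    = \<ominus> sg (k + 1) x \<oplus> \<ominus> sg k y \<oplus> (\<ominus> T k \<oplus> \<ominus> ?S)"
    using T S sg x y by (simp add: minus_add a_ac)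
  finally show ?case
    using sum sg x y by simp
qed

section \<open>The free algebra is a ring and a module over its coefficients\<close>

lemma carrier_free_algebra_iff:
  "p \<in> carrier (free_algebra F X) \<longleftrightarrow> (\<forall>w. p w \<in> carrier F) \<and>
    finite {w. p w \<noteq> \<zero>\<^bsub>F\<^esub>} \<and> {w. p w \<noteq> \<zero>\<^bsub>F\<^esub>} \<subseteq> lists X"
  by (auto simp: free_algebra_def)

lemma free_algebra_sel:
  "\<zero>\<^bsub>free_algebra F X\<^esub> = (\<lambda>w. \<zero>\<^bsub>F\<^esub>)"
  "\<one>\<^bsub>free_algebra F X\<^esub> = (\<lambda>w. if w = [] then \<one>\<^bsub>F\<^esub> else \<zero>\<^bsub>F\<^esub>)"
  "p \<oplus>\<^bsub>free_algebra F X\<^esub> q = (\<lambda>w. p w \<oplus>\<^bsub>F\<^esub> q w)"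
  "p \<otimes>\<^bsub>free_algebra F X\<^esub> q =
    (\<lambda>w. \<Oplus>\<^bsub>F\<^esub>k\<in>{..length w}. p (take k w) \<otimes>\<^bsub>F\<^esub> q (drop k w))"
  "c \<odot>\<^bsub>free_algebra F X\<^esub> p = (\<lambda>w. c \<otimes>\<^bsub>F\<^esub> p w)"
  by (simp_all add: free_algebra_def)

context cring
begin

text \<open>Any finite set \<open>S\<close> of words over \<open>X\<close> that encloses the support
  will do, so cancellation in sums and products need not be traced.\<close>

lemma free_algebra_supportI:
  assumes "\<And>w. p w \<in> carrier R" "finite S" "S \<subseteq> lists X" "\<And>w. p w \<noteq> \<zero> \<Longrightarrow> w \<in> S"
  shows "p \<in> carrier (free_algebra R X)"
  unfolding carrier_free_algebra_iff using assms by (auto intro: finite_subset[of _ S])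

lemma free_algebra_add_closed:
  assumes "p \<in> carrier (free_algebra R X)" "q \<in> carrier (free_algebra R X)"
  shows "p \<oplus>\<^bsub>free_algebra R X\<^esub> q \<in> carrier (free_algebra R X)"
proof (rule free_algebra_supportI)
  fix w assume "(p \<oplus>\<^bsub>free_algebra R X\<^esub> q) w \<noteq> \<zero>"
  then show "w \<in> {w. p w \<noteq> \<zero>} \<union> {w. q w \<noteq> \<zero>}"
    by (auto simp: free_algebra_sel)
qed (use assms in \<open>auto simp: carrier_free_algebra_iff free_algebra_sel\<close>)

lemma free_algebra_smult_closed:
  assumes "c \<in> carrier R" "p \<in> carrier (free_algebra R X)"
  shows "c \<odot>\<^bsub>free_algebra R X\<^esub> p \<in> carrier (free_algebra R X)"
proof (rule free_algebra_supportI)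
  fix w assume "(c \<odot>\<^bsub>free_algebra R X\<^esub> p) w \<noteq> \<zero>"
  then show "w \<in> {w. p w \<noteq> \<zero>}"
    using assms by (auto simp: free_algebra_sel)
qed (use assms in \<open>auto simp: carrier_free_algebra_iff free_algebra_sel\<close>)

lemma free_algebra_mult_closed:
  assumes p: "p \<in> carrier (free_algebra R X)" and q: "q \<in> carrier (free_algebra R X)"
  shows "p \<otimes>\<^bsub>free_algebra R X\<^esub> q \<in> carrier (free_algebra R X)"
proof (rule free_algebra_supportI)
  \<comment> \<open>A word with nonzero coefficient in the product splits into a word of the support
    of \<open>p\<close> followed by one of the support of \<open>q\<close>.\<close>
  let ?S = "(\<lambda>(u, v). u @ v) ` ({w. p w \<noteq> \<zero>} \<times> {w. q w \<noteq> \<zero>})"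
  show "(p \<otimes>\<^bsub>free_algebra R X\<^esub> q) w \<in> carrier R" for w
    using p q by (auto simp: carrier_free_algebra_iff free_algebra_sel)
  show "finite ?S"
    using p q by (auto simp: carrier_free_algebra_iff)
  have "u \<in> lists X" if "p u \<noteq> \<zero> \<or> q u \<noteq> \<zero>" for u
    using p q that unfolding carrier_free_algebra_iff by blast
  then show "?S \<subseteq> lists X"
    by auto (metis in_lists_conv_set)+
  fix w assume "(p \<otimes>\<^bsub>free_algebra R X\<^esub> q) w \<noteq> \<zero>"
  then obtain k where k: "p (take k w) \<otimes> q (drop k w) \<noteq> \<zero>"
    unfolding free_algebra_sel by (rule finsum_nonzero_ex)
  with p q have "p (take k w) \<noteq> \<zero>" "q (drop k w) \<noteq> \<zero>"
    by (auto simp: carrier_free_algebra_iff)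
  then show "w \<in> ?S"
    by (intro image_eqI[of _ _ "(take k w, drop k w)"]) auto
qed

lemma free_algebra_one_closed: "\<one>\<^bsub>free_algebra R X\<^esub> \<in> carrier (free_algebra R X)"
  by (rule free_algebra_supportI[of _ "{[]}"]) (auto simp: free_algebra_sel split: if_splits)

text \<open>Both coefficients at \<open>w\<close> sum over the ways to cut \<open>w\<close> into
  three consecutive pieces. The left side groups the cuts by the joint length of the first two
  pieces, the right side by the length of the first; \<open>finsum_triangle\<close> compares the two
  orders.\<close>

lemma free_algebra_mult_assoc:
  assumes "p \<in> carrier (free_algebra R X)" "q \<in> carrier (free_algebra R X)"
    "s \<in> carrier (free_algebra R X)"
  shows "p \<otimes>\<^bsub>free_algebra R X\<^esub> q \<otimes>\<^bsub>free_algebra R X\<^esub> s =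
    p \<otimes>\<^bsub>free_algebra R X\<^esub> (q \<otimes>\<^bsub>free_algebra R X\<^esub> s)"
proof
  fix w
  have mem: "p v \<in> carrier R" "q v \<in> carrier R" "s v \<in> carrier R" for v
    using assms by (auto simp: carrier_free_algebra_iff)
  \<comment> \<open>Here \<open>j\<close> and \<open>i\<close> are the lengths of the first and of
    the second piece.\<close>
  let ?f = "\<lambda>j i. p (take j w) \<otimes> q (take i (drop j w)) \<otimes> s (drop i (drop j w))"
  have "(p \<otimes>\<^bsub>free_algebra R X\<^esub> q \<otimes>\<^bsub>free_algebra R X\<^esub> s) w
      = (\<Oplus>k\<in>{..length w}. \<Oplus>j\<in>{..k}. ?f j (k - j))"
    unfolding free_algebra_sel
  proof (rule finsum_cong')
    fix k assume k: "k \<in> {..length w}"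
    have "(\<Oplus>j\<in>{..length (take k w)}. p (take j (take k w)) \<otimes> q (drop j (take k w))) \<otimes> s (drop k w)
        = (\<Oplus>j\<in>{..length (take k w)}. p (take j (take k w)) \<otimes> q (drop j (take k w)) \<otimes> s (drop k w))"
      by (rule finsum_ldistr) (auto simp: mem)
    also have "\<dots> = (\<Oplus>j\<in>{..k}. ?f j (k - j))"
      using k by (intro finsum_cong') (auto simp: mem drop_take min_def)
    finally show "(\<Oplus>j\<in>{..length (take k w)}. p (take j (take k w)) \<otimes> q (drop j (take k w)))
      \<otimes> s (drop k w) = (\<Oplus>j\<in>{..k}. ?f j (k - j))" .
  qed (auto simp: mem)
  also have "\<dots> = (\<Oplus>j\<in>{..length w}. \<Oplus>i\<in>{..length w - j}. ?f j i)"
    by (rule finsum_triangle) (auto simp: mem)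
  also have "\<dots> = (p \<otimes>\<^bsub>free_algebra R X\<^esub> (q \<otimes>\<^bsub>free_algebra R X\<^esub> s)) w"
    unfolding free_algebra_sel
    by (rule finsum_cong') (simp_all add: mem m_assoc finsum_rdistr)
  finally show "(p \<otimes>\<^bsub>free_algebra R X\<^esub> q \<otimes>\<^bsub>free_algebra R X\<^esub> s) w
    = (p \<otimes>\<^bsub>free_algebra R X\<^esub> (q \<otimes>\<^bsub>free_algebra R X\<^esub> s)) w" .
qed

lemma free_algebra_one_mult:
  assumes "p \<in> carrier (free_algebra R X)"
  shows "\<one>\<^bsub>free_algebra R X\<^esub> \<otimes>\<^bsub>free_algebra R X\<^esub> p = p"
    and "p \<otimes>\<^bsub>free_algebra R X\<^esub> \<one>\<^bsub>free_algebra R X\<^esub> = p"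
proof -
  have mem: "p v \<in> carrier R" for v
    using assms by (auto simp: carrier_free_algebra_iff)
  show "\<one>\<^bsub>free_algebra R X\<^esub> \<otimes>\<^bsub>free_algebra R X\<^esub> p = p"
  proof
    fix w
    \<comment> \<open>Only the cut with empty prefix contributes.\<close>
    have "(\<one>\<^bsub>free_algebra R X\<^esub> \<otimes>\<^bsub>free_algebra R X\<^esub> p) w
      = (\<Oplus>k\<in>{..length w}. if 0 = k then p w else \<zero>)"
      unfolding free_algebra_sel by (rule finsum_cong') (auto simp: mem)
    also have "\<dots> = p w"
      using finsum_singleton[of 0 "{..length w}" "\<lambda>_. p w"] mem by auto
    finally show "(\<one>\<^bsub>free_algebra R X\<^esub> \<otimes>\<^bsub>free_algebra R X\<^esub> p) w = p w" .
  qed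
  show "p \<otimes>\<^bsub>free_algebra R X\<^esub> \<one>\<^bsub>free_algebra R X\<^esub> = p"
  proof
    fix w
    have "(p \<otimes>\<^bsub>free_algebra R X\<^esub> \<one>\<^bsub>free_algebra R X\<^esub>) w
      = (\<Oplus>k\<in>{..length w}. if length w = k then p w else \<zero>)"
      unfolding free_algebra_sel by (rule finsum_cong') (auto simp: mem)
    also have "\<dots> = p w"
      using finsum_singleton[of "length w" "{..length w}" "\<lambda>_. p w"] mem by auto
    finally show "(p \<otimes>\<^bsub>free_algebra R X\<^esub> \<one>\<^bsub>free_algebra R X\<^esub>) w = p w" .
  qed
qed

lemma free_algebra_abelian_group: "abelian_group (free_algebra R X)"
proof (rule abelian_groupI)
  show "\<zero>\<^bsub>free_algebra R X\<^esub> \<in> carrier (free_algebra R X)"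
    by (auto simp: carrier_free_algebra_iff free_algebra_sel)
  show "\<exists>q\<in>carrier (free_algebra R X). q \<oplus>\<^bsub>free_algebra R X\<^esub> p = \<zero>\<^bsub>free_algebra R X\<^esub>"
    if p: "p \<in> carrier (free_algebra R X)" for p
  proof
    \<comment> \<open>The additive inverse is the multiple by -1, whose support is already
      controlled by closure under scalars.\<close>
    show "(\<ominus> \<one>) \<odot>\<^bsub>free_algebra R X\<^esub> p \<in> carrier (free_algebra R X)"
      using p by (intro free_algebra_smult_closed) auto
    show "(\<ominus> \<one>) \<odot>\<^bsub>free_algebra R X\<^esub> p \<oplus>\<^bsub>free_algebra R X\<^esub> p = \<zero>\<^bsub>free_algebra R X\<^esub>"
      using p by (simp add: carrier_free_algebra_iff free_algebra_sel l_minus l_neg)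
  qed
next
  fix p q s
  assume "p \<in> carrier (free_algebra R X)" "q \<in> carrier (free_algebra R X)"
    "s \<in> carrier (free_algebra R X)"
  then show "(p \<oplus>\<^bsub>free_algebra R X\<^esub> q) \<oplus>\<^bsub>free_algebra R X\<^esub> s
    = p \<oplus>\<^bsub>free_algebra R X\<^esub> (q \<oplus>\<^bsub>free_algebra R X\<^esub> s)"
    by (simp add: carrier_free_algebra_iff free_algebra_sel a_assoc)
next
  fix p q
  assume "p \<in> carrier (free_algebra R X)" "q \<in> carrier (free_algebra R X)"
  then show "p \<oplus>\<^bsub>free_algebra R X\<^esub> q = q \<oplus>\<^bsub>free_algebra R X\<^esub> p"
    by (simp add: carrier_free_algebra_iff free_algebra_sel a_comm)
next
  fix p
  assume "p \<in> carrier (free_algebra R X)"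
  then show "\<zero>\<^bsub>free_algebra R X\<^esub> \<oplus>\<^bsub>free_algebra R X\<^esub> p = p"
    by (simp add: carrier_free_algebra_iff free_algebra_sel)
qed (rule free_algebra_add_closed)

lemma free_algebra_ring: "ring (free_algebra R X)"
proof (rule ringI)
  show "abelian_group (free_algebra R X)" by (rule free_algebra_abelian_group)
  show "monoid (free_algebra R X)"
    by unfold_locales (auto intro: free_algebra_mult_closed free_algebra_one_closed
        simp: free_algebra_mult_assoc free_algebra_one_mult)
  fix p q s
  assume "p \<in> carrier (free_algebra R X)" "q \<in> carrier (free_algebra R X)"
    "s \<in> carrier (free_algebra R X)"
  then have mem: "p v \<in> carrier R" "q v \<in> carrier R" "s v \<in> carrier R" for v
    by (auto simp: carrier_free_algebra_iff)
  show "(p \<oplus>\<^bsub>free_algebra R X\<^esub> q) \<otimes>\<^bsub>free_algebra R X\<^esub> s =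
    p \<otimes>\<^bsub>free_algebra R X\<^esub> s \<oplus>\<^bsub>free_algebra R X\<^esub> q \<otimes>\<^bsub>free_algebra R X\<^esub> s"
    unfolding free_algebra_sel by (simp add: mem l_distr finsum_addf)
  show "s \<otimes>\<^bsub>free_algebra R X\<^esub> (p \<oplus>\<^bsub>free_algebra R X\<^esub> q) =
    s \<otimes>\<^bsub>free_algebra R X\<^esub> p \<oplus>\<^bsub>free_algebra R X\<^esub> s \<otimes>\<^bsub>free_algebra R X\<^esub> q"
    unfolding free_algebra_sel by (simp add: mem r_distr finsum_addf)
qed

lemma free_algebra_module: "module R (free_algebra R X)"
proof (rule moduleI)
  fix a p q
  assume "a \<in> carrier R" "p \<in> carrier (free_algebra R X)" "q \<in> carrier (free_algebra R X)"
  then show "a \<odot>\<^bsub>free_algebra R X\<^esub> (p \<oplus>\<^bsub>free_algebra R X\<^esub> q) =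
      a \<odot>\<^bsub>free_algebra R X\<^esub> p \<oplus>\<^bsub>free_algebra R X\<^esub> a \<odot>\<^bsub>free_algebra R X\<^esub> q"
    by (simp add: carrier_free_algebra_iff free_algebra_sel r_distr)
next
  fix a b p
  assume "a \<in> carrier R" "b \<in> carrier R" "p \<in> carrier (free_algebra R X)"
  then show
    "(a \<oplus> b) \<odot>\<^bsub>free_algebra R X\<^esub> p =
      a \<odot>\<^bsub>free_algebra R X\<^esub> p \<oplus>\<^bsub>free_algebra R X\<^esub> b \<odot>\<^bsub>free_algebra R X\<^esub> p"
    "(a \<otimes> b) \<odot>\<^bsub>free_algebra R X\<^esub> p = a \<odot>\<^bsub>free_algebra R X\<^esub> (b \<odot>\<^bsub>free_algebra R X\<^esub> p)"
    by (simp_all add: carrier_free_algebra_iff free_algebra_sel l_distr m_assoc)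
next
  fix p
  assume "p \<in> carrier (free_algebra R X)"
  then show "\<one> \<odot>\<^bsub>free_algebra R X\<^esub> p = p"
    by (simp add: carrier_free_algebra_iff free_algebra_sel)
qed (auto simp: free_algebra_abelian_group free_algebra_smult_closed cring_axioms)

lemma free_algebra_smult_one_mult:
  assumes "c \<in> carrier R" "p \<in> carrier (free_algebra R X)"
  shows "(c \<odot>\<^bsub>free_algebra R X\<^esub> \<one>\<^bsub>free_algebra R X\<^esub>) \<otimes>\<^bsub>free_algebra R X\<^esub> p
    = c \<odot>\<^bsub>free_algebra R X\<^esub> p"
proof
  fix w
  have mem: "p v \<in> carrier R" for v
    using assms by (auto simp: carrier_free_algebra_iff)
  have "((c \<odot>\<^bsub>free_algebra R X\<^esub> \<one>\<^bsub>free_algebra R X\<^esub>) \<otimes>\<^bsub>free_algebra R X\<^esub> p) w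
    = (\<Oplus>k\<in>{..length w}. if 0 = k then c \<otimes> p w else \<zero>)"
    unfolding free_algebra_sel by (rule finsum_cong') (auto simp: mem assms)
  also have "\<dots> = c \<otimes> p w"
    using finsum_singleton[of 0 "{..length w}" "\<lambda>_. c \<otimes> p w"] mem assms by auto
  finally show "((c \<odot>\<^bsub>free_algebra R X\<^esub> \<one>\<^bsub>free_algebra R X\<^esub>) \<otimes>\<^bsub>free_algebra R X\<^esub> p) w
    = (c \<odot>\<^bsub>free_algebra R X\<^esub> p) w"
    by (simp add: free_algebra_sel)
qed

lemma free_gen_closed: "g \<in> X \<Longrightarrow> free_gen R g \<in> carrier (free_algebra R X)"
  by (rule free_algebra_supportI[of _ "{[g]}"]) (auto simp: free_gen_def split: if_splits)

text \<open>Scaling by \<open>c\<close> is left multiplication by the multiple \<open>c\<close> of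
  the unit, so a ring ideal is automatically a submodule. This makes scalar multiplication on the
  quotient well defined.\<close>

lemma smult_ideal_free_algebra:
  assumes "ideal I (free_algebra R X)" "c \<in> carrier R" "x \<in> I"
  shows "c \<odot>\<^bsub>free_algebra R X\<^esub> x \<in> I"
proof -
  interpret I: ideal I "free_algebra R X" by fact
  have "(c \<odot>\<^bsub>free_algebra R X\<^esub> \<one>\<^bsub>free_algebra R X\<^esub>) \<otimes>\<^bsub>free_algebra R X\<^esub> x \<in> I"
    using assms by (intro I.I_l_closed free_algebra_smult_closed) auto
  then show ?thesis
    using assms I.Icarr by (simp add: free_algebra_smult_one_mult)
qed

end

section \<open>Quotients of algebras by ideals\<close>

lemma quot_algebra_ring:
  assumes "ideal I R"
  shows "ring (quot_algebra R I)"
    and "(+>\<^bsub>R\<^esub>) I \<in> ring_hom R (quot_algebra R I)"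
proof -
  interpret I: ideal I R by fact
  let ?Q = "quot_algebra R I"
  have sel: "carrier ?Q = carrier (R Quot I)" "mult ?Q = mult (R Quot I)"
    "one ?Q = one (R Quot I)" "add ?Q = add (R Quot I)" "zero ?Q = zero (R Quot I)"
    by (simp_all add: quot_algebra_def ring.defs)
  \<comment> \<open>The two records share all ring operations and differ only by the scalar field;
    the ring axioms are transported along the identity map.\<close>
  have "id \<in> ring_hom (R Quot I) ?Q"
    by (auto simp: ring_hom_def sel)
  from ring.ring_hom_imp_img_ring[OF I.quotient_is_ring this]
  have "ring (?Q\<lparr>carrier := carrier ?Q, zero := zero ?Q\<rparr>)"
    by (simp add: sel)
  then show "ring ?Q" by simp
  show "(+>\<^bsub>R\<^esub>) I \<in> ring_hom R ?Q"
    using I.rcos_ring_hom by (simp add: ring_hom_def sel)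
qed

text \<open>The union defining the scalar multiple runs over all representatives \<open>y\<close> of
  the coset of \<open>x\<close>. Each such \<open>y\<close> differs from \<open>x\<close> by an
  element of \<open>I\<close>, and \<open>c\<close> maps \<open>I\<close> into itself, so all
  members of the union are the same coset.\<close>

lemma quot_algebra_smult:
  assumes "ideal I R" "module F R" "c \<in> carrier F" "x \<in> carrier R"
    and "\<And>y. y \<in> I \<Longrightarrow> c \<odot>\<^bsub>R\<^esub> y \<in> I"
  shows "c \<odot>\<^bsub>quot_algebra R I\<^esub> (I +>\<^bsub>R\<^esub> x) = I +>\<^bsub>R\<^esub> (c \<odot>\<^bsub>R\<^esub> x)"
proof -
  interpret I: ideal I R by fact
  interpret M: module F R by fact
  have "I +>\<^bsub>R\<^esub> (c \<odot>\<^bsub>R\<^esub> y) = I +>\<^bsub>R\<^esub> (c \<odot>\<^bsub>R\<^esub> x)" if y: "y \<in> I +>\<^bsub>R\<^esub> x" for y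
  proof -
    obtain h where h: "h \<in> I" "y = h \<oplus>\<^bsub>R\<^esub> x"
      using y by (auto simp: a_r_coset_def')
    then have "c \<odot>\<^bsub>R\<^esub> y \<in> I +>\<^bsub>R\<^esub> (c \<odot>\<^bsub>R\<^esub> x)"
      using assms I.Icarr by (auto simp: a_r_coset_def' M.smult_r_distr)
    then show ?thesis
      using assms by (intro I.a_repr_independence'[symmetric]) auto
  qed
  moreover have "x \<in> I +>\<^bsub>R\<^esub> x"
    using assms by (intro I.a_rcos_self)
  ultimately have "(\<Union>y\<in>I +>\<^bsub>R\<^esub> x. I +>\<^bsub>R\<^esub> (c \<odot>\<^bsub>R\<^esub> y)) = I +>\<^bsub>R\<^esub> (c \<odot>\<^bsub>R\<^esub> x)"
    by blast
  then show ?thesis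
    by (simp add: quot_algebra_def ring.defs module.defs)
qed

section \<open>Relations in \<open>A(d, F)\<close>\<close>

locale A_algebra_over_cring = cring F for F :: "('f, 'm) ring_scheme" (structure) +
  fixes d :: nat
begin

abbreviation "A \<equiv> A_algebra F d"
abbreviation "FA \<equiv> free_algebra F (idems d)"
abbreviation "pr \<equiv> (+>\<^bsub>FA\<^esub>) (A_ideal F d)"

sublocale FA: ring FA
  by (rule free_algebra_ring)

lemma gen_closed: "index g \<le> d \<Longrightarrow> free_gen F g \<in> carrier FA"
  by (rule free_gen_closed) (simp add: idems_def)

lemma A_relators_subset: "A_relators F d \<subseteq> carrier FA"
  unfolding A_relators_def Let_def
  by (auto intro!: FA.minus_closed FA.m_closed FA.finsum_closed gen_closed)

sublocale I: ideal "A_ideal F d" FA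
  unfolding A_ideal_def by (rule FA.genideal_ideal[OF A_relators_subset])

lemma relator_in_ideal: "x \<in> A_relators F d \<Longrightarrow> x \<in> A_ideal F d"
  unfolding A_ideal_def using FA.genideal_self[OF A_relators_subset] by blast

lemma pr_hom: "pr \<in> ring_hom FA A"
  unfolding A_algebra_def by (rule quot_algebra_ring) (rule I.ideal_axioms)

sublocale A: ring A
  unfolding A_algebra_def by (rule quot_algebra_ring) (rule I.ideal_axioms)

sublocale pr: ring_hom_ring FA A pr
  by (intro ring_hom_ringI2 FA.ring_axioms A.ring_axioms pr_hom)

text \<open>Relators are encoded as differences; this turns each of them back into an equation in
  \<open>A\<close>.\<close>

lemma pr_eqI:
  assumes "x \<in> carrier FA" "y \<in> carrier FA" "x \<ominus>\<^bsub>FA\<^esub> y \<in> A_relators F d"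
  shows "pr x = pr y"
  using FA.quotient_eq_iff_same_a_r_cos[OF I.ideal_axioms] assms relator_in_ideal by blast

lemma A_gen_closed: "index g \<le> d \<Longrightarrow> A_gen F d g \<in> carrier A"
  unfolding A_gen_def by (intro pr.hom_closed gen_closed)

lemma A_gen_mult:
  assumes "index g \<le> d" "index h \<le> d" "starred g = starred h"
  shows "A_gen F d g \<otimes>\<^bsub>A\<^esub> A_gen F d h = (if index g = index h then A_gen F d g else \<zero>\<^bsub>A\<^esub>)"
proof -
  have "pr (free_gen F g \<otimes>\<^bsub>FA\<^esub> free_gen F h)
      = pr (if index g = index h then free_gen F g else \<zero>\<^bsub>FA\<^esub>)"
  proof (rule pr_eqI)
    show "free_gen F g \<otimes>\<^bsub>FA\<^esub> free_gen F h
      \<ominus>\<^bsub>FA\<^esub> (if index g = index h then free_gen F g else \<zero>\<^bsub>FA\<^esub>) \<in> A_relators F d"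
      using assms unfolding A_relators_def Let_def
      by (cases g; cases h) auto
  qed (use assms in \<open>auto intro: gen_closed\<close>)
  then show ?thesis
    using assms by (auto simp: A_gen_def gen_closed)
qed

lemma A_gen_sum:
  assumes "T = Nonstar \<or> T = Star"
  shows "(\<Oplus>\<^bsub>A\<^esub>i\<in>{..d}. A_gen F d (T i)) = \<one>\<^bsub>A\<^esub>"
proof -
  have cl: "(\<lambda>i. free_gen F (T i)) \<in> {..d} \<rightarrow> carrier FA"
    using assms by (auto intro: gen_closed)
  have "pr \<one>\<^bsub>FA\<^esub> = pr (\<Oplus>\<^bsub>FA\<^esub>i\<in>{..d}. free_gen F (T i))"
  proof (rule pr_eqI)
    show "\<one>\<^bsub>FA\<^esub> \<ominus>\<^bsub>FA\<^esub> (\<Oplus>\<^bsub>FA\<^esub>i\<in>{..d}. free_gen F (T i)) \<in> A_relators F d"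
      using assms unfolding A_relators_def Let_def by auto
  qed (use cl in auto)
  then show ?thesis
    using pr.hom_finsum[OF cl] by (simp add: A_gen_def comp_def)
qed

text \<open>The coefficients in the product formula are signs, so the scalars 1 and -1 are the ones
  to evaluate. This is done on a representative in the free algebra.\<close>

lemma A_smult:
  assumes "x \<in> carrier A"
  shows "\<one> \<odot>\<^bsub>A\<^esub> x = x" and "(\<ominus> \<one>) \<odot>\<^bsub>A\<^esub> x = \<ominus>\<^bsub>A\<^esub> x"
proof -
  interpret M: module F FA by (rule free_algebra_module)
  obtain y where y: "y \<in> carrier FA" "x = pr y"
    using assms unfolding A_algebra_def quot_algebra_def
    by (auto simp: ring.defs FactRing_def A_RCOSETS_def')
  have *: "c \<odot>\<^bsub>A\<^esub> x = pr (c \<odot>\<^bsub>FA\<^esub> y)" if "c \<in> carrier F" for c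
    unfolding A_algebra_def y(2)
    by (rule quot_algebra_smult[OF I.ideal_axioms M.module_axioms that y(1)])
      (rule smult_ideal_free_algebra[OF I.ideal_axioms that])
  show "\<one> \<odot>\<^bsub>A\<^esub> x = x"
    by (subst *) (simp_all add: y)
  show "(\<ominus> \<one>) \<odot>\<^bsub>A\<^esub> x = \<ominus>\<^bsub>A\<^esub> x"
    by (subst *) (simp_all add: y M.smult_l_minus)
qed

text \<open>This links powers of -1 acting as scalars to the case distinction on parity used in
  \<open>alternating_recurrence\<close>.\<close>

lemma A_smult_sign:
  assumes "x \<in> carrier A"
  shows "((\<ominus> \<one>) [^] (k::nat)) \<odot>\<^bsub>A\<^esub> x = (if even k then x else \<ominus>\<^bsub>A\<^esub> x)"
proof -
  have "(\<ominus> \<one>) [^] k = (if even k then \<one> else \<ominus> \<one>)"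
    by (induction k) (auto simp: l_minus)
  then show ?thesis
    using assms by (simp add: A_smult)
qed

lemma A_prod_Nil [simp]: "A_prod F d [] = \<one>\<^bsub>A\<^esub>"
  and A_prod_Cons [simp]: "A_prod F d (g # gs) = A_gen F d g \<otimes>\<^bsub>A\<^esub> A_prod F d gs"
  by (simp_all add: A_prod_def)

lemma A_prod_closed: "set gs \<subseteq> idems d \<Longrightarrow> A_prod F d gs \<in> carrier A"
  by (induction gs) (auto simp: idems_def A_gen_closed)

lemma A_prod_append:
  "set gs \<subseteq> idems d \<Longrightarrow> set hs \<subseteq> idems d \<Longrightarrow>
    A_prod F d (gs @ hs) = A_prod F d gs \<otimes>\<^bsub>A\<^esub> A_prod F d hs"
  by (induction gs) (auto simp: A_prod_closed A_gen_closed A.m_assoc idems_def)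

text \<open>Orthogonality of the idempotents of one kind, applied inside a product. The lists are
  arbitrary, so products that fail to alternate can be treated as well.\<close>

lemma A_prod_collapse:
  assumes "set gs \<subseteq> idems d" "set hs \<subseteq> idems d" "g \<in> idems d" "h \<in> idems d"
    and "starred g = starred h"
  shows "A_prod F d (gs @ g # h # hs) =
    (if index g = index h then A_prod F d (gs @ g # hs) else \<zero>\<^bsub>A\<^esub>)"
proof -
  have gh: "A_gen F d g \<in> carrier A" "A_gen F d h \<in> carrier A"
    "A_prod F d hs \<in> carrier A" "A_prod F d gs \<in> carrier A"
    using assms by (auto simp: idems_def A_gen_closed A_prod_closed)
  have "A_prod F d (gs @ g # h # hs)
    = A_prod F d gs \<otimes>\<^bsub>A\<^esub> (A_gen F d g \<otimes>\<^bsub>A\<^esub> A_gen F d h \<otimes>\<^bsub>A\<^esub> A_prod F d hs)"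
    using assms gh by (simp add: A_prod_append A.m_assoc)
  also have "A_gen F d g \<otimes>\<^bsub>A\<^esub> A_gen F d h
    = (if index g = index h then A_gen F d g else \<zero>\<^bsub>A\<^esub>)"
    using assms by (intro A_gen_mult) (auto simp: idems_def)
  finally show ?thesis
    using assms gh by (simp add: A_prod_append)
qed

text \<open>The idempotents of one kind sum to 1, so summing over all insertions of such an
  idempotent at a fixed place inserts 1 there.\<close>

lemma A_prod_sum:
  assumes gs: "set gs \<subseteq> idems d" and hs: "set hs \<subseteq> idems d" and T: "T = Nonstar \<or> T = Star"
  shows "(\<Oplus>\<^bsub>A\<^esub>i\<in>{..d}. A_prod F d (gs @ T i # hs)) = A_prod F d (gs @ hs)"
proof -
  have T_idem: "T i \<in> idems d" if "i \<le> d" for i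
    using T that by (auto simp: idems_def)
  then have Tcl: "A_gen F d (T i) \<in> carrier A" if "i \<le> d" for i
    using that by (intro A_gen_closed) (auto simp: idems_def)
  have cl: "A_prod F d gs \<in> carrier A" "A_prod F d hs \<in> carrier A"
    using gs hs by (auto simp: A_prod_closed)
  have "(\<Oplus>\<^bsub>A\<^esub>i\<in>{..d}. A_prod F d (gs @ T i # hs))
    = (\<Oplus>\<^bsub>A\<^esub>i\<in>{..d}. A_prod F d gs \<otimes>\<^bsub>A\<^esub> (A_gen F d (T i) \<otimes>\<^bsub>A\<^esub> A_prod F d hs))"
    using gs hs T_idem Tcl cl by (intro A.finsum_cong') (auto simp: A_prod_append)
  \<comment> \<open>Distributivity on both sides moves the fixed outer factors out of the
    sum.\<close>
  also have "\<dots> = A_prod F d gs \<otimes>\<^bsub>A\<^esub>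
      ((\<Oplus>\<^bsub>A\<^esub>i\<in>{..d}. A_gen F d (T i)) \<otimes>\<^bsub>A\<^esub> A_prod F d hs)"
    using Tcl cl by (subst A.finsum_ldistr, simp, simp, force, subst A.finsum_rdistr) auto
  also have "\<dots> = A_prod F d (gs @ hs)"
    using gs hs cl by (simp add: A_gen_sum[OF T] A_prod_append)
  finally show ?thesis .
qed

end

section \<open>Words and their products\<close>

text \<open>List positions start at 0: a cut after the first \<open>l\<close> entries separates
  \<open>r\<^sub>l\<close>, which is \<open>xs ! (l - 1)\<close>, from
  \<open>r\<^sub>l\<^sub>+\<^sub>1\<close>, which is \<open>xs ! l\<close>.\<close>

lemma last_take_hd_drop:
  assumes "1 \<le> l" "l < length xs"
  shows "take l xs \<noteq> []" "drop l xs \<noteq> []" "last (take l xs) = xs ! (l - 1)" "hd (drop l xs) = xs ! l"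
proof -
  show ne: "take l xs \<noteq> []" "drop l xs \<noteq> []"
    using assms by auto
  show "last (take l xs) = xs ! (l - 1)" "hd (drop l xs) = xs ! l"
    using assms by (simp_all add: last_conv_nth[OF ne(1)] hd_drop_conv_nth min_def)
qed

text \<open>
  The kind of a generator is determined by the parity of what follows it, so appending an odd number
  of indices exchanges starred and nonstarred generators.
\<close>

primrec toggle :: "idem \<Rightarrow> idem" where
  "toggle (Nonstar i) = Star i"
| "toggle (Star i) = Nonstar i"

lemma bracket_append:
  "bracket (xs @ ys) = (if even (length ys) then bracket xs else map toggle (bracket xs)) @ bracket ys"
  by (induction xs) auto

lemma bracket_eq_Nil_iff [simp]: "bracket s = [] \<longleftrightarrow> s = []"
  by (cases s) auto

lemma set_bracket_subset_iff: "set (bracket s) \<subseteq> idems d \<longleftrightarrow> set s \<subseteq> {..d}"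
  by (induction s) (auto simp: idems_def)

lemma set_toggle_bracket: "set s \<subseteq> {..d} \<Longrightarrow> set (map toggle (bracket s)) \<subseteq> idems d"
  by (induction s) (auto simp: idems_def)

text \<open>Alternation of kinds and a nonstarred last generator are built into
  \<open>bracket\<close>, which leaves conditions on the indices alone.\<close>

lemma NR_nonstar_bracket_iff:
  "NR_nonstar d (bracket s) \<longleftrightarrow> s \<noteq> [] \<and> set s \<subseteq> {..d} \<and> successively (\<noteq>) s"
proof -
  have idx: "map index (bracket s) = s"
    by (induction s) auto
  have "nonrepeating (bracket s) \<longleftrightarrow> successively (\<noteq>) (map index (bracket s))"
    unfolding nonrepeating_def successively_map ..
  moreover have "successively (\<lambda>g h. starred g \<noteq> starred h) (bracket s)"
  proof (induction s)
    case (Cons a s)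
    then show ?case by (cases s) auto
  qed simp
  moreover have "s \<noteq> [] \<Longrightarrow> \<not> starred (last (bracket s))"
    by (induction s) auto
  ultimately show ?thesis
    unfolding NR_nonstar_def is_word_def by (auto simp: idx set_bracket_subset_iff)
qed

section \<open>Products and sums of words given by their index sequences\<close>

context A_algebra_over_cring
begin

abbreviation "W s \<equiv> A_prod F d (bracket s)"

lemma W_closed: "set s \<subseteq> {..d} \<Longrightarrow> W s \<in> carrier A"
  by (simp add: A_prod_closed set_bracket_subset_iff)

text \<open>An even number of appended indices preserves the kinds in the left word, so the product
  is plain concatenation.\<close>

lemma W_append:
  assumes "set xs \<subseteq> {..d}" "set ys \<subseteq> {..d}" "even (length ys)"
  shows "W (xs @ ys) = W xs \<otimes>\<^bsub>A\<^esub> W ys"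
  using assms by (simp add: bracket_append A_prod_append set_bracket_subset_iff)

text \<open>A word of odd length that ends nonstarred also begins nonstarred. Two nonstarred
  generators therefore meet at the junction, and they merge or annihilate.\<close>

lemma W_mult_odd:
  assumes "set xs \<subseteq> {..d}" "set ys \<subseteq> {..d}" "xs \<noteq> []" "odd (length ys)"
  shows "W xs \<otimes>\<^bsub>A\<^esub> W ys = (if last xs = hd ys then W (xs @ tl ys) else \<zero>\<^bsub>A\<^esub>)"
proof -
  obtain us a where xs: "xs = us @ [a]"
    using assms(3) by (metis rev_exhaust)
  obtain b vs where ys: "ys = b # vs"
    using assms(4) by (cases ys) auto
  let ?us = "map toggle (bracket us)"
  have sets: "set ?us \<subseteq> idems d" "set (bracket vs) \<subseteq> idems d"
    "Nonstar a \<in> idems d" "Nonstar b \<in> idems d"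
    using assms(1,2) set_toggle_bracket[of us d]
    by (simp_all add: xs ys set_bracket_subset_iff) (simp_all add: idems_def)
  have "W xs \<otimes>\<^bsub>A\<^esub> W ys = A_prod F d ((?us @ [Nonstar a]) @ Nonstar b # bracket vs)"
    using assms(4) sets by (subst A_prod_append) (auto simp: xs ys bracket_append)
  also have "\<dots> = (if a = b then A_prod F d (?us @ Nonstar a # bracket vs) else \<zero>\<^bsub>A\<^esub>)"
    using A_prod_collapse[OF sets] by simp
  finally show ?thesis
    using assms(4) by (simp add: xs ys bracket_append)
qed

lemma W_sum_Cons:
  assumes "set ys \<subseteq> {..d}"
  shows "(\<Oplus>\<^bsub>A\<^esub>j\<in>{..d}. W (j # ys)) = W ys"
  using A_prod_sum[of "[]" "bracket ys" Nonstar] A_prod_sum[of "[]" "bracket ys" Star] assms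
  by (cases "even (length ys)") (simp_all add: set_bracket_subset_iff)

text \<open>Summing over \<open>j\<close> inserts 1 between the neighbours \<open>last xs\<close>
  and \<open>hd ys\<close>. These are two places apart in each summand, hence of the same kind; with
  different indices their product is 0.\<close>

lemma W_sum_insert:
  assumes "set xs \<subseteq> {..d}" "set ys \<subseteq> {..d}" "xs \<noteq> []" "ys \<noteq> []" "last xs \<noteq> hd ys"
  shows "(\<Oplus>\<^bsub>A\<^esub>j\<in>{..d}. W (xs @ j # ys)) = \<zero>\<^bsub>A\<^esub>"
proof -
  obtain us a where xs: "xs = us @ [a]"
    using assms(3) by (metis rev_exhaust)
  obtain b vs where ys: "ys = b # vs"
    using assms(4) by (cases ys) auto
  \<comment> \<open>\<open>S\<close> is the common kind of the two neighbours, \<open>T\<close> the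
    opposite kind of the inserted generator, and \<open>gs\<close> the prefix with the kinds it has
    once three further indices and \<open>vs\<close> follow it.\<close>
  define S where "S = (if even (length vs) then Nonstar else Star)"
  define T where "T = (if even (length vs) then Star else Nonstar)"
  define gs where "gs = (if even (length vs) then map toggle (bracket us) else bracket us)"
  have sets: "set gs \<subseteq> idems d" "set (bracket vs) \<subseteq> idems d" "S a \<in> idems d" "S b \<in> idems d"
    using assms(1,2) set_toggle_bracket[of us d]
    by (simp_all add: xs ys set_bracket_subset_iff gs_def S_def) (simp_all add: idems_def)
  have T: "T = Nonstar \<or> T = Star"
    by (simp add: T_def)
  have "W (xs @ j # ys) = A_prod F d ((gs @ [S a]) @ T j # S b # bracket vs)" for j
    by (simp add: xs ys bracket_append gs_def S_def T_def)
  then have "(\<Oplus>\<^bsub>A\<^esub>j\<in>{..d}. W (xs @ j # ys)) = A_prod F d ((gs @ [S a]) @ S b # bracket vs)"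
    using A_prod_sum[of "gs @ [S a]" "S b # bracket vs", OF _ _ T] sets by simp
  also have "\<dots> = \<zero>\<^bsub>A\<^esub>"
    using A_prod_collapse[OF sets] assms(5) by (simp add: xs ys S_def)
  finally show ?thesis .
qed

text \<open>The product in the case of even \<open>m\<close> and equal indices at the junction is
  the word with \<open>last r\<close> repeated, and this expands it. The tail \<open>t\<close> is
  arbitrary because every insertion takes place before it.\<close>

lemma W_repeat_expansion:
  assumes r: "set r \<subseteq> {..d}" "successively (\<noteq>) r" "r \<noteq> []" and t: "set t \<subseteq> {..d}"
  defines "n \<equiv> length r"
    and "sg \<equiv> \<lambda>(k::nat) x. if even k then x else \<ominus>\<^bsub>A\<^esub> x"
  shows "W (r @ last r # t) =
    sg (n + 1) (W (r @ t))
    \<oplus>\<^bsub>A\<^esub> sg n (\<Oplus>\<^bsub>A\<^esub>j\<in>{..d} - {hd r}. W (j # r @ t))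
    \<oplus>\<^bsub>A\<^esub> (\<Oplus>\<^bsub>A\<^esub>l\<in>{1..n - 1}. sg (n - l)
        (\<Oplus>\<^bsub>A\<^esub>j\<in>{..d} - {r ! (l - 1), r ! l}. W (take l r @ [j] @ drop l r @ t)))"
proof -
  \<comment> \<open>Since \<open>drop (l - 1) r\<close> starts with the \<open>l\<close>-th entry
    again, \<open>U l\<close> is the word with that entry doubled.\<close>
  define U where "U l = W (take l r @ drop (l - 1) r @ t)" for l
  define T where "T l = (\<Oplus>\<^bsub>A\<^esub>j\<in>{..d} - {r ! (l - 1), r ! l}.
    W (take l r @ [j] @ drop l r @ t))" for l
  have td: "set (take l r) \<subseteq> {..d}" "set (drop l r) \<subseteq> {..d}" for l
    using r(1) set_take_subset[of l r] set_drop_subset[of l r] by blast+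
  have n: "1 \<le> n"
    using r(3) by (cases r) (auto simp: n_def)
  have Ucl: "U l \<in> carrier A" for l
    unfolding U_def using td t by (intro W_closed) auto
  have ins_cl: "W (take l r @ [j] @ drop l r @ t) \<in> carrier A" if "j \<le> d" for j l
    using td t that by (intro W_closed) auto
  \<comment> \<open>Keeping \<open>[j] @ _\<close> unsimplified lets the summands match
    \<open>ins_cl\<close>.\<close>
  have Tcl: "T l \<in> carrier A" for l
    unfolding T_def by (intro A.finsum_closed) (auto simp del: append_Cons append_Nil intro: ins_cl)
  have cons_cl: "W (j # r @ t) \<in> carrier A" if "j \<le> d" for j
    using r t that by (intro W_closed) auto
  have hd_le: "hd r \<le> d"
    using r by (cases r) auto
  \<comment> \<open>Inserting 1 in front of \<open>r\<close> leaves the word unchanged; the summand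
    \<open>j = hd r\<close> doubles the first entry and is \<open>U 1\<close>.\<close>
  have "W (r @ t) = (\<Oplus>\<^bsub>A\<^esub>j\<in>insert (hd r) ({..d} - {hd r}). W (j # r @ t))"
    using hd_le r t W_sum_Cons[of "r @ t"] by (simp add: insert_absorb)
  also have "\<dots> = W (hd r # r @ t) \<oplus>\<^bsub>A\<^esub> (\<Oplus>\<^bsub>A\<^esub>j\<in>{..d} - {hd r}. W (j # r @ t))"
    using cons_cl hd_le by (intro A.finsum_insert) auto
  also have "W (hd r # r @ t) = U 1"
    using r(3) by (cases r) (auto simp: U_def)
  finally have base: "W (r @ t) = (\<Oplus>\<^bsub>A\<^esub>j\<in>{..d} - {hd r}. W (j # r @ t)) \<oplus>\<^bsub>A\<^esub> U 1"
    using cons_cl Ucl by (subst A.a_comm) (auto intro!: A.finsum_closed)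
  have step: "T l \<oplus>\<^bsub>A\<^esub> (U l \<oplus>\<^bsub>A\<^esub> U (Suc l)) = \<zero>\<^bsub>A\<^esub>" if l: "1 \<le> l" "l < n" for l
  proof -
    note lr = last_take_hd_drop[of l r, folded n_def, OF l]
    have ne: "r ! (l - 1) \<noteq> r ! l"
      using r(2) l successively_nth[of "(\<noteq>)" r "l - 1"] by (simp add: n_def)
    have mem: "r ! (l - 1) \<in> {..d}" "r ! l \<in> {..d}"
      using l subsetD[OF r(1) nth_mem, of "l - 1"] subsetD[OF r(1) nth_mem, of l]
      by (simp_all add: n_def)
    \<comment> \<open>Of the indices inserted at the cut, the left neighbour produces
      \<open>U l\<close> and the right neighbour \<open>U (Suc l)\<close>; all others are collected
      in \<open>T l\<close>.\<close>
    have "take l r @ [r ! (l - 1)] @ drop l r @ t = take l r @ drop (l - 1) r @ t"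
      using Cons_nth_drop_Suc[of "l - 1" r] l by (simp add: n_def)
    then have U1: "W (take l r @ [r ! (l - 1)] @ drop l r @ t) = U l"
      by (simp only: U_def)
    have "take l r @ [r ! l] @ drop l r @ t = take (Suc l) r @ drop (Suc l - 1) r @ t"
      using l by (simp add: n_def take_Suc_conv_app_nth)
    then have U2: "W (take l r @ [r ! l] @ drop l r @ t) = U (Suc l)"
      by (simp only: U_def)
    \<comment> \<open>The neighbours at the cut differ because \<open>r\<close> is nonrepeating, so
      the full sum over \<open>j\<close> vanishes.\<close>
    have "\<zero>\<^bsub>A\<^esub> = (\<Oplus>\<^bsub>A\<^esub>j\<in>{..d}. W (take l r @ [j] @ drop l r @ t))"
      using W_sum_insert[of "take l r" "drop l r @ t"] td t lr ne by simp
    also have "\<dots> = T l \<oplus>\<^bsub>A\<^esub> (U l \<oplus>\<^bsub>A\<^esub> U (Suc l))"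
      unfolding T_def U1[symmetric] U2[symmetric] using mem ne
      by (intro A.finsum_remove2) (auto simp del: append_Cons append_Nil intro: ins_cl)
    finally show ?thesis ..
  qed
  have "W (r @ last r # t) = U n"
    using r(3) by (cases r rule: rev_cases) (auto simp: U_def n_def)
  also have "\<dots> = sg (n + 1) (W (r @ t))
    \<oplus>\<^bsub>A\<^esub> sg n (\<Oplus>\<^bsub>A\<^esub>j\<in>{..d} - {hd r}. W (j # r @ t))
    \<oplus>\<^bsub>A\<^esub> (\<Oplus>\<^bsub>A\<^esub>l\<in>{1..n - 1}. sg (n - l) (T l))"
    \<comment> \<open>The recurrence is evaluated at its last index \<open>k = n\<close>, with
      \<open>x\<close> the unrepeated word and \<open>y\<close> the sum of the insertions in
      front.\<close>
    unfolding sg_def using r t n cons_cl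
    by (intro A.alternating_recurrence[where n = n] Ucl Tcl base step W_closed A.finsum_closed) auto
  finally show ?thesis
    unfolding T_def .
qed

end

section \<open>Assembly of the four cases of the product formula\<close>

theorem theorem4p1:
  fixes F :: "('f, 'm) ring_scheme"
    and d n m :: nat
    and r r' :: "nat list"
  assumes "field F"
    and "d \<ge> 1" and "n \<ge> 1" and "m \<ge> 1"
    and "length r = n" and "length r' = m"
    and "NR_nonstar d (bracket r)" and "NR_nonstar d (bracket r')"
  shows
    "let A = A_algebra F d;
         W = (\<lambda>s. A_prod F d (bracket s));
         NR = (\<lambda>s. NR_nonstar d (bracket s));
         sgn = (\<lambda>k::nat. (\<ominus>\<^bsub>F\<^esub> \<one>\<^bsub>F\<^esub>) [^]\<^bsub>F\<^esub> k);
         P = W r \<otimes>\<^bsub>A\<^esub> W r'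
     in
      (odd m \<and> last r \<noteq> hd r' \<longrightarrow> P = \<zero>\<^bsub>A\<^esub>)
      \<and> (odd m \<and> last r = hd r' \<longrightarrow> NR (r @ tl r') \<and> P = W (r @ tl r'))
      \<and> (even m \<and> last r \<noteq> hd r' \<longrightarrow> NR (r @ r') \<and> P = W (r @ r'))
      \<and> (even m \<and> last r = hd r' \<longrightarrow>
           NR (r @ tl r')
         \<and> (\<forall>j\<in>{0..d} - {hd r}. NR (j # r @ tl r'))
         \<and> (\<forall>l\<in>{1..n - 1}. \<forall>j\<in>{0..d} - {r ! (l - 1), r ! l}.
              NR (take l r @ [j] @ drop l r @ tl r'))
         \<and> P = (sgn (n + 1) \<odot>\<^bsub>A\<^esub> W (r @ tl r'))
             \<oplus>\<^bsub>A\<^esub> (sgn n \<odot>\<^bsub>A\<^esub> (\<Oplus>\<^bsub>A\<^esub>j\<in>{0..d} - {hd r}. W (j # r @ tl r')))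
             \<oplus>\<^bsub>A\<^esub> (\<Oplus>\<^bsub>A\<^esub>l\<in>{1..n - 1}. sgn (n - l) \<odot>\<^bsub>A\<^esub>
                  (\<Oplus>\<^bsub>A\<^esub>j\<in>{0..d} - {r ! (l - 1), r ! l}.
                     W (take l r @ [j] @ drop l r @ tl r'))))"
proof -
  interpret F: field F by fact
  interpret A_algebra_over_cring F d by unfold_locales
  have r: "r \<noteq> []" "set r \<subseteq> {..d}" "successively (\<noteq>) r"
    and r': "r' \<noteq> []" "set r' \<subseteq> {..d}" "successively (\<noteq>) r'"
    using assms(7,8) by (auto simp del: bracket.simps simp: NR_nonstar_bracket_iff)
  define t where "t = tl r'"
  have r't: "r' = hd r' # t"
    using r'(1) by (simp add: t_def)
  have t: "set t \<subseteq> {..d}"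
    using r'(2) by (subst (asm) r't) auto
  \<comment> \<open>With \<open>last r = hd r'\<close>, the junction condition for
    \<open>r @ t\<close> is the one between the first two entries of \<open>r'\<close>; it is void
    when \<open>t\<close> is empty.\<close>
  have rt: "successively (\<noteq>) (r @ t)" if "last r = hd r'"
    using that r r'(3) by (subst (asm) r't) (auto simp: successively_append_iff successively_Cons)
  have NR_rt: "NR_nonstar d (bracket (r @ t))" if "last r = hd r'"
    using that rt r t by (auto simp del: bracket.simps simp: NR_nonstar_bracket_iff)
  have NR_app: "NR_nonstar d (bracket (r @ r'))" if "last r \<noteq> hd r'"
    using that r r' by (auto simp del: bracket.simps simp: NR_nonstar_bracket_iff successively_append_iff)
  have NR_Cons: "NR_nonstar d (bracket (j # r @ t))"
    if "last r = hd r'" "j \<in> {0..d} - {hd r}" for j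
    using that rt r t by (auto simp del: bracket.simps simp: NR_nonstar_bracket_iff successively_Cons)
  have NR_ins: "NR_nonstar d (bracket (take l r @ [j] @ drop l r @ t))"
    if "last r = hd r'" "l \<in> {1..n - 1}" "j \<in> {0..d} - {r ! (l - 1), r ! l}" for l j
  proof -
    have l: "1 \<le> l" "l < length r"
      using that assms(5) by auto
    note lr = last_take_hd_drop[OF l]
    have "successively (\<noteq>) (take l r @ drop l r @ t)"
      using rt[OF that(1)] by (simp flip: append_assoc)
    \<comment> \<open>Inserting \<open>j\<close> creates two new adjacent pairs, and
      \<open>j\<close> is chosen different from both neighbours.\<close>
    then have "successively (\<noteq>) (take l r @ [j] @ drop l r @ t)"
      using lr that(3) by (auto simp: successively_append_iff successively_Cons)
    moreover have "set (take l r @ [j] @ drop l r @ t) \<subseteq> {..d}"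
      using r(2) t that(3) set_take_subset[of l r] set_drop_subset[of l r] by auto
    ultimately show ?thesis
      by (simp add: NR_nonstar_bracket_iff)
  qed
  have expansion: "W r \<otimes>\<^bsub>A\<^esub> W r' =
    ((\<ominus>\<^bsub>F\<^esub> \<one>\<^bsub>F\<^esub>) [^]\<^bsub>F\<^esub> (n + 1)) \<odot>\<^bsub>A\<^esub> W (r @ t)
    \<oplus>\<^bsub>A\<^esub> ((\<ominus>\<^bsub>F\<^esub> \<one>\<^bsub>F\<^esub>) [^]\<^bsub>F\<^esub> n) \<odot>\<^bsub>A\<^esub> (\<Oplus>\<^bsub>A\<^esub>j\<in>{0..d} - {hd r}. W (j # r @ t))
    \<oplus>\<^bsub>A\<^esub> (\<Oplus>\<^bsub>A\<^esub>l\<in>{1..n - 1}. ((\<ominus>\<^bsub>F\<^esub> \<one>\<^bsub>F\<^esub>) [^]\<^bsub>F\<^esub> (n - l)) \<odot>\<^bsub>A\<^esub>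
        (\<Oplus>\<^bsub>A\<^esub>j\<in>{0..d} - {r ! (l - 1), r ! l}. W (take l r @ [j] @ drop l r @ t)))"
    if "even m" "last r = hd r'"
  proof -
    have cl: "W (r @ t) \<in> carrier A"
      "(\<Oplus>\<^bsub>A\<^esub>j\<in>{..d} - {hd r}. W (j # r @ t)) \<in> carrier A"
      using r t by (intro W_closed A.finsum_closed funcsetI; auto)+
    have ins_cl: "(\<Oplus>\<^bsub>A\<^esub>j\<in>{..d} - {r ! (l - 1), r ! l}. W (take l r @ [j] @ drop l r @ t))
      \<in> carrier A" for l
      using r(2) t set_take_subset[of l r] set_drop_subset[of l r]
      by (intro A.finsum_closed funcsetI W_closed) auto
    \<comment> \<open>As \<open>m\<close> is even the product is concatenation, and
      \<open>last r = hd r'\<close> makes the result a word with its junction index doubled.\<close>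
    have "W r \<otimes>\<^bsub>A\<^esub> W r' = W (r @ r')"
      using that r r' assms(6) by (simp add: W_append)
    also have "r @ r' = r @ last r # t"
      using that by (subst r't) simp
    finally show ?thesis
      \<comment> \<open>The scalar signs of the claim become parity distinctions, and both sides
        then agree literally.\<close>
      unfolding W_repeat_expansion[OF r(2,3,1) t] atLeast0AtMost assms(5)
        A_smult_sign[OF cl(1)] A_smult_sign[OF cl(2)] A_smult_sign[OF ins_cl] .
  qed
  show ?thesis
    unfolding Let_def t_def[symmetric]
    using W_mult_odd[of r r'] W_append[of r r'] r r' assms(6) NR_rt NR_app NR_Cons NR_ins expansion
    by (auto simp del: A_prod_Cons bracket.simps append_Cons append_Nil simp: t_def)
qed

end
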